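(* Let $G$ be a connected graph with $|V(G)|\ge 2$. Let $e\in E(G)$ be neither a loop nor a cut-edge, and let $U\subseteq V(G)$. Then $$\tilde\chi(\Delta^G_U)=\tilde\chi(\Delta^{G/e}_{U/e})-\tilde\chi(\Delta^{G\setminus e}_U).$$
   Context: Graphs are finite and undirected; loops and parallel edges are allowed. $G\setminus e$ is $G$ with the edge $e$ deleted (same vertex set). $G/e$ is obtained by removing $e=\{v,w\}$ and identifying its endpoints into a single vertex $vw$, keeping all other edges (so edges parallel to $e$ become loops). For $U\subseteq V(G)$, $U/e=U$ if $v,w\notin U$, and $U/e=(U\setminus\{v,w\})\cup\{vw\}$ otherwise. A cut-edge is an edge $e$ such that $G\setminus e$ has more components than $G$. A nucleus of $G$ is a (nonempty) connected subgraph $N\subseteq G$ such that $V(N)$ is a vertex cover of $G$ (every edge of $G$, including loops, has at least one endpoint in $V(N)$); a single vertex with no edges is allowed as a connected subgraph. $\mathcal{N}(G)$ is the set of nuclei. For a connected graph $G$ and $U\subseteq V(G)$, the $U$-nucleus complex is the simplicial complex on vertex set $E(G)$ $$\Delta^G_U=\{E(G)\setminus E(N): N\in\mathcal{N}(G),\ V(N)\supseteq U\}.$$ One exception: if $G=cK_2$ is the graph with two vertices joined by $c\ge1$ parallel edges and no loops, and $U=\emptyset$, then $\Delta^{cK_2}_\emptyset$ is the $\Delta$-complex consisting of two $(c-1)$-dimensional simplices on vertex set $E(cK_2)$ glued along their boundaries (one top simplex for each of the two single-vertex nuclei, counted separately). The reduced Euler characteristic is $\tilde\chi(\Delta)=\sum_{\sigma}(-1)^{\dim\sigma}$,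 the sum over all faces $\sigma$ including the empty face, with $\dim\sigma=|\sigma|-1$. *)

theory Defs
  imports Main
begin

text \<open>
  Undirected multigraphs: \<open>ends G f\<close> is the set of endpoints of the edge \<open>f\<close>, a singleton
  exactly when \<open>f\<close> is a loop. Values of \<open>ends G\<close> outside \<open>edges G\<close> are irrelevant.
\<close>

record ('v, 'e) mgraph =
  verts :: "'v set"
  edges :: "'e set"
  ends :: "'e \<Rightarrow> 'v set"

definition wf_mgraph :: "('v, 'e) mgraph \<Rightarrow> bool" where
  "wf_mgraph G \<longleftrightarrow> finite (verts G) \<and> finite (edges G) \<and>
     (\<forall>f\<in>edges G. ends G f \<subseteq> verts G \<and> card (ends G f) \<in> {1, 2})"

definition is_loop :: "('v, 'e) mgraph \<Rightarrow> 'e \<Rightarrow> bool" where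
  "is_loop G f \<longleftrightarrow> card (ends G f) = 1"

definition adj_rel :: "('v, 'e) mgraph \<Rightarrow> 'v rel" where
  "adj_rel G = {(x, y). \<exists>f\<in>edges G. ends G f = {x, y}}"

definition reach_rel :: "('v, 'e) mgraph \<Rightarrow> 'v rel" where
  "reach_rel G = (adj_rel G)\<^sup>* \<inter> verts G \<times> verts G"

definition components :: "('v, 'e) mgraph \<Rightarrow> 'v set set" where
  "components G = verts G // reach_rel G"

definition connected_mgraph :: "('v, 'e) mgraph \<Rightarrow> bool" where
  "connected_mgraph G \<longleftrightarrow>
     verts G \<noteq> {} \<and> (\<forall>x\<in>verts G. \<forall>y\<in>verts G. (x, y) \<in> reach_rel G)"

definition delete_edge :: "('v, 'e) mgraph \<Rightarrow> 'e \<Rightarrow> ('v, 'e) mgraph" where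
  "delete_edge G e = G\<lparr>edges := edges G - {e}\<rparr>"

definition cut_edge :: "('v, 'e) mgraph \<Rightarrow> 'e \<Rightarrow> bool" where
  "cut_edge G e \<longleftrightarrow> e \<in> edges G \<and> card (components (delete_edge G e)) > card (components G)"

text \<open>
  The vertices of \<open>G/e\<close> are sets of vertices of \<open>G\<close>: for \<open>e = {v, w}\<close> the merged vertex \<open>vw\<close>
  is the set \<open>{v, w}\<close>, and every other vertex \<open>x\<close> is renamed to \<open>{x}\<close>.
\<close>

definition contract_vertex :: "('v, 'e) mgraph \<Rightarrow> 'e \<Rightarrow> 'v \<Rightarrow> 'v set" where
  "contract_vertex G e x = (if x \<in> ends G e then ends G e else {x})"

definition contract_edge :: "('v, 'e) mgraph \<Rightarrow> 'e \<Rightarrow> ('v set, 'e) mgraph" where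
  "contract_edge G e =
     \<lparr>verts = contract_vertex G e ` verts G,
      edges = edges G - {e},
      ends = (\<lambda>f. contract_vertex G e ` ends G f)\<rparr>"

definition contract_set :: "('v, 'e) mgraph \<Rightarrow> 'e \<Rightarrow> 'v set \<Rightarrow> 'v set set" where
  "contract_set G e U =
     (if ends G e \<inter> U = {} then (\<lambda>x. {x}) ` U
      else (\<lambda>x. {x}) ` (U - ends G e) \<union> {ends G e})"

definition subgraph :: "('v, 'e) mgraph \<Rightarrow> ('v, 'e) mgraph \<Rightarrow> bool" where
  "subgraph H G \<longleftrightarrow> verts H \<subseteq> verts G \<and> edges H \<subseteq> edges G \<and> ends H = ends G \<and>
     (\<forall>f\<in>edges H. ends H f \<subseteq> verts H)"

definition vertex_cover :: "('v, 'e) mgraph \<Rightarrow> 'v set \<Rightarrow> bool" where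
  "vertex_cover G C \<longleftrightarrow> C \<subseteq> verts G \<and> (\<forall>f\<in>edges G. ends G f \<inter> C \<noteq> {})"

definition nuclei :: "('v, 'e) mgraph \<Rightarrow> ('v, 'e) mgraph set" where
  "nuclei G = {N. subgraph N G \<and> connected_mgraph N \<and> vertex_cover G (verts N)}"

definition is_cK2 :: "('v, 'e) mgraph \<Rightarrow> bool" where
  "is_cK2 G \<longleftrightarrow> card (verts G) = 2 \<and> edges G \<noteq> {} \<and> (\<forall>f\<in>edges G. ends G f = verts G)"

text \<open>
  A complex is given by its faces, including the empty face. A face is its set of simplex
  vertices (here: edges of the graph) together with a label, which allows distinct faces of a
  \<open>\<Delta>\<close>-complex to have the same vertex set; the faces of a simplicial complex all have the
  label \<open>None\<close>.
\<close>

type_synonym ('v, 'e) face = "'v option \<times> 'e set"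

definition simplicial :: "'e set set \<Rightarrow> ('v, 'e) face set" where
  "simplicial K = {None} \<times> K"

text \<open>
  Two full simplices on \<open>edges G\<close>, one for each vertex of \<open>G = cK\<^sub>2\<close>, glued along their
  common boundary: the proper faces are shared, the two top faces are labelled by the vertices.
\<close>

definition glued_simplices :: "('v, 'e) mgraph \<Rightarrow> ('v, 'e) face set" where
  "glued_simplices G =
     simplicial {\<sigma>. \<sigma> \<subset> edges G} \<union> {(Some v, edges G) | v. v \<in> verts G}"

definition nucleus_complex :: "('v, 'e) mgraph \<Rightarrow> 'v set \<Rightarrow> ('v, 'e) face set" where
  "nucleus_complex G U =
     (if is_cK2 G \<and> U = {} then glued_simplices G
      else simplicial {edges G - edges N | N. N \<in> nuclei G \<and> U \<subseteq> verts N})"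

text \<open>
  The exponent \<open>card \<sigma> + 1\<close> is \<open>dim \<sigma> + 2\<close>, a natural number also for the empty face,
  which has dimension \<open>-1\<close>.
\<close>

definition reduced_euler_char :: "('v, 'e) face set \<Rightarrow> int" where
  "reduced_euler_char K = (\<Sum>(l, \<sigma>)\<in>K. (- 1) ^ (card \<sigma> + 1))"

end

theory Submission imports Defs begin

text \<open>
  Up to sign, the reduced Euler characteristic of the \<open>U\<close>-nucleus complex counts nuclei: it is
  the signed sum, over all nuclei \<open>N\<close> with \<open>U \<subseteq> V(N)\<close>, of \<open>(-1) ^ (|E(G) - E(N)| + 1)\<close>
  (\<open>reduced_euler_char_nucleus_complex\<close>). The point is that \<open>N\<close> is determined by \<open>E(N)\<close> unless
  \<open>E(N)\<close> is empty. Two different one-vertex nuclei can exist only if every edge joins their two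
  vertices, and this is the exceptional graph \<open>cK\<^sub>2\<close> with \<open>U = {}\<close>, whose complex has by
  definition one top face for each of the two.

  The recursion is then a matching of nuclei. Let \<open>A\<close> and \<open>B\<close> be the nuclei of \<open>G\<close> that use and
  do not use \<open>e\<close>, and let \<open>C\<close> be the nuclei of \<open>G \ e\<close> that contain neither endpoint of \<open>e\<close>
  (always with vertex set including \<open>U\<close>).
  \<^item> The nuclei of \<open>G\<close> are \<open>A \<union> B\<close>.
  \<^item> The nuclei of \<open>G \ e\<close> are \<open>B \<union> C\<close>: a nucleus of \<open>G \ e\<close> is one of \<open>G\<close> exactly if it
    covers \<open>e\<close>.
  \<^item> The nuclei of \<open>G / e\<close> correspond to \<open>A \<union> C\<close> by contracting \<open>e\<close> (\<open>bij_betw_contract_nuclei\<close>):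
    those through the merged vertex come from \<open>A\<close>, the others from \<open>C\<close>.

  Deleting \<open>e\<close> lowers \<open>|E(G) - E(N)|\<close> by one for \<open>N\<close> in \<open>B\<close> and leaves it unchanged for \<open>N\<close> in
  \<open>A\<close>. So in the difference of the sums for \<open>G / e\<close> and \<open>G \ e\<close> the family \<open>C\<close> cancels, \<open>A\<close>
  appears with its sign for \<open>G\<close>, and so does \<open>B\<close>. That \<open>e\<close> is not a cut-edge serves to make
  \<open>G \ e\<close> connected, so that its Euler characteristic is a sum over nuclei.
\<close>

section \<open>Connected graphs and subgraphs\<close>

lemma ends_cases:
  assumes "wf_mgraph G" and "f \<in> edges G"
  obtains x y where "ends G f = {x, y}"
proof -
  have "card (ends G f) = 1 \<or> card (ends G f) = 2"
    using assms by (auto simp: wf_mgraph_def)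
  then show thesis
    using that by (metis card_1_singletonE card_2_iff insert_absorb2)
qed

lemma subgraph_ends: "subgraph H G \<Longrightarrow> f \<in> edges H \<Longrightarrow> ends H f \<subseteq> verts H"
  unfolding subgraph_def by (elim conjE) (rule bspec)

lemma wf_mgraph_subgraph:
  assumes "wf_mgraph G" and "subgraph H G"
  shows "wf_mgraph H"
  using assms unfolding wf_mgraph_def subgraph_def
  by (metis finite_subset subsetD)

lemma connected_mgraph_iff_adj:
  "connected_mgraph G \<longleftrightarrow>
     verts G \<noteq> {} \<and> (\<forall>x\<in>verts G. \<forall>y\<in>verts G. (x, y) \<in> (adj_rel G)\<^sup>*)"
  by (auto simp: connected_mgraph_def reach_rel_def)

lemma connected_incident_edge:
  assumes "connected_mgraph G" and "x \<in> verts G" and "y \<in> verts G" and "x \<noteq> y"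
  obtains f where "f \<in> edges G" and "x \<in> ends G f"
proof -
  have "(x, y) \<in> (adj_rel G)\<^sup>*"
    using assms by (auto simp: connected_mgraph_iff_adj)
  then obtain z where "(x, z) \<in> adj_rel G"
    using \<open>x \<noteq> y\<close> by (meson converse_rtranclE)
  then show thesis
    using that by (auto simp: adj_rel_def)
qed

lemma connected_no_edges:
  assumes "connected_mgraph G" and "edges G = {}"
  obtains x where "verts G = {x}"
proof -
  obtain x where "x \<in> verts G"
    using assms by (auto simp: connected_mgraph_def)
  then have "verts G = {x}"
    using connected_incident_edge[OF assms(1)] assms(2) by blast
  then show thesis using that by blast
qed

lemma connected_verts_eq_Union_ends:
  assumes "wf_mgraph G" and "connected_mgraph G" and "edges G \<noteq> {}"
  shows "verts G = \<Union> (ends G ` edges G)"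
proof
  show "\<Union> (ends G ` edges G) \<subseteq> verts G"
    using assms(1) by (auto simp: wf_mgraph_def)
  show "verts G \<subseteq> \<Union> (ends G ` edges G)"
  proof
    fix x assume x: "x \<in> verts G"
    obtain f where f: "f \<in> edges G" using assms(3) by blast
    then obtain y z where yz: "ends G f = {y, z}"
      using ends_cases[OF assms(1)] by blast
    then have y: "y \<in> verts G"
      using f assms(1) by (auto simp: wf_mgraph_def)
    show "x \<in> \<Union> (ends G ` edges G)"
    proof (cases "x = y")
      case True
      then show ?thesis using f yz by blast
    next
      case False
      then show ?thesis using connected_incident_edge[OF assms(2) x y] by blast
    qed
  qed
qed

lemma subgraph_eqI:
  fixes N N' :: "('v, 'e) mgraph"
  assumes "subgraph N G" and "subgraph N' G" and "verts N = verts N'" and "edges N = edges N'"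
  shows "N = N'"
  using assms by (auto simp: subgraph_def intro: mgraph.equality)

lemma finite_nuclei:
  assumes "wf_mgraph G"
  shows "finite (nuclei G)"
proof (rule inj_on_finite)
  show "inj_on (\<lambda>N. (verts N, edges N)) (nuclei G)"
    by (auto simp: nuclei_def inj_on_def intro: subgraph_eqI)
  show "(\<lambda>N. (verts N, edges N)) ` nuclei G \<subseteq> Pow (verts G) \<times> Pow (edges G)"
    by (auto simp: nuclei_def subgraph_def)
  show "finite (Pow (verts G) \<times> Pow (edges G))"
    using assms by (auto simp: wf_mgraph_def)
qed

section \<open>The Euler characteristic as a sum over nuclei\<close>

definition nuclei_over :: "('v, 'e) mgraph \<Rightarrow> 'v set \<Rightarrow> ('v, 'e) mgraph set" where
  "nuclei_over G U = {N \<in> nuclei G. U \<subseteq> verts N}"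

lemma is_cK2_nucleus_iff:
  fixes G N :: "('v, 'e) mgraph"
  assumes "is_cK2 G"
  shows "N \<in> nuclei G \<longleftrightarrow> ends N = ends G \<and> edges N \<subseteq> edges G \<and>
     (edges N = {} \<and> (\<exists>v\<in>verts G. verts N = {v}) \<or> edges N \<noteq> {} \<and> verts N = verts G)"
    (is "_ \<longleftrightarrow> ?R")
proof -
  obtain a b where ab: "verts G = {a, b}" "a \<noteq> b"
    using assms by (metis card_2_iff is_cK2_def)
  have ends: "ends G f = {a, b}" if "f \<in> edges G" for f
    using assms that ab by (simp add: is_cK2_def)
  show ?thesis
  proof
    assume N: "N \<in> nuclei G"
    show ?R
    proof (cases "edges N = {}")
      case True
      then obtain x where "verts N = {x}"
        using N connected_no_edges by (auto simp: nuclei_def)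
      then show ?thesis using N True by (auto simp: nuclei_def subgraph_def)
    next
      case False
      then obtain f where "f \<in> edges N" by blast
      then have "ends G f = verts G" "ends G f \<subseteq> verts N" "verts N \<subseteq> verts G"
        using N ends ab by (simp_all add: nuclei_def subgraph_def subset_iff)
      then show ?thesis using N False by (auto simp: nuclei_def subgraph_def)
    qed
  next
    assume R: ?R
    have "subgraph N G"
      using R ends ab by (auto simp: subgraph_def)
    moreover have "vertex_cover G (verts N)"
      using R ends ab by (auto simp: vertex_cover_def)
    moreover have "connected_mgraph N"
    proof (cases "edges N = {}")
      case True
      then show ?thesis using R by (auto simp: connected_mgraph_iff_adj)
    next
      case False
      then obtain f where f: "f \<in> edges N" by blast
      then have "ends N f = {a, b}"
        using R ends by auto
      then have "(a, b) \<in> adj_rel N" "(b, a) \<in> adj_rel N"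
        using f unfolding adj_rel_def by auto
      then show ?thesis
        using R False ab by (auto simp: connected_mgraph_iff_adj)
    qed
    ultimately show "N \<in> nuclei G" by (simp add: nuclei_def)
  qed
qed

text \<open>
  The two one-vertex nuclei of \<open>cK\<^sub>2\<close> are the two top faces; a nucleus with edges has both
  vertices, and any nonempty set of edges is allowed, so these give the proper faces.
\<close>

lemma bij_betw_nuclei_glued_simplices:
  fixes G :: "('v, 'e) mgraph"
  assumes "is_cK2 G"
  shows "bij_betw
     (\<lambda>N. (if edges N = {} then Some (the_elem (verts N)) else None, edges G - edges N))
     (nuclei G) (glued_simplices G)"
proof (rule bij_betwI')
  fix N N' :: "('v, 'e) mgraph"
  assume N: "N \<in> nuclei G" "N' \<in> nuclei G"
  show "((if edges N = {} then Some (the_elem (verts N)) else None, edges G - edges N) =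
         (if edges N' = {} then Some (the_elem (verts N')) else None, edges G - edges N'))
        = (N = N')" (is "?L = _")
  proof
    assume L: ?L
    have "edges N = edges N'"
      using L N by (auto simp: nuclei_def subgraph_def)
    moreover have "verts N = verts N'"
      using L N is_cK2_nucleus_iff[OF assms] by (auto split: if_splits)
    ultimately show "N = N'"
      using N by (auto simp: nuclei_def intro: subgraph_eqI)
  qed simp
next
  fix N :: "('v, 'e) mgraph"
  assume "N \<in> nuclei G"
  then show "(if edges N = {} then Some (the_elem (verts N)) else None, edges G - edges N)
      \<in> glued_simplices G"
    using is_cK2_nucleus_iff[OF assms, of N]
    by (auto simp: glued_simplices_def simplicial_def)
next
  fix \<phi> :: "('v, 'e) face"
  assume "\<phi> \<in> glued_simplices G"
  then consider \<sigma> where "\<phi> = (None, \<sigma>)" "\<sigma> \<subset> edges G"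
    | v where "\<phi> = (Some v, edges G)" "v \<in> verts G"
    by (auto simp: glued_simplices_def simplicial_def)
  then show "\<exists>N\<in>nuclei G.
      \<phi> = (if edges N = {} then Some (the_elem (verts N)) else None, edges G - edges N)"
  proof cases
    case 1
    then have "\<lparr>verts = verts G, edges = edges G - \<sigma>, ends = ends G\<rparr> \<in> nuclei G"
      by (auto simp: is_cK2_nucleus_iff[OF assms])
    then show ?thesis by (rule rev_bexI) (use 1 in auto)
  next
    case 2
    then have "\<lparr>verts = {v}, edges = {}, ends = ends G\<rparr> \<in> nuclei G"
      by (auto simp: is_cK2_nucleus_iff[OF assms])
    then show ?thesis by (rule rev_bexI) (use 2 in auto)
  qed
qed

text \<open>
  If \<open>{v}\<close> and \<open>{w}\<close> both cover all edges, then every edge joins \<open>v\<close> and \<open>w\<close>, and connectedness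
  leaves room for no further vertex.
\<close>

lemma is_cK2_if_two_point_covers:
  assumes wf: "wf_mgraph G" and conn: "connected_mgraph G" and "v \<noteq> w"
    and v: "vertex_cover G {v}" and w: "vertex_cover G {w}"
  shows "is_cK2 G"
proof -
  have ends: "ends G f = {v, w}" if f: "f \<in> edges G" for f
  proof -
    have "v \<in> ends G f" "w \<in> ends G f"
      using v w f by (auto simp: vertex_cover_def)
    moreover obtain x y where "ends G f = {x, y}"
      using ends_cases[OF wf f] .
    ultimately show ?thesis using \<open>v \<noteq> w\<close> by auto
  qed
  have vw: "v \<in> verts G" "w \<in> verts G"
    using v w by (auto simp: vertex_cover_def)
  have ne: "edges G \<noteq> {}"
    using connected_incident_edge[OF conn vw \<open>v \<noteq> w\<close>] by blast
  have "verts G = {v, w}"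
    using connected_verts_eq_Union_ends[OF wf conn ne] ends ne by auto
  then show ?thesis
    using ends ne \<open>v \<noteq> w\<close> by (auto simp: is_cK2_def)
qed

lemma inj_on_edges_nuclei_over:
  assumes wf: "wf_mgraph G" and conn: "connected_mgraph G"
    and not_cK2: "\<not> (is_cK2 G \<and> U = {})"
  shows "inj_on edges (nuclei_over G U)"
proof (rule inj_onI)
  fix N N'
  assume N: "N \<in> nuclei_over G U" and N': "N' \<in> nuclei_over G U" and eq: "edges N = edges N'"
  have sub: "subgraph N G" "subgraph N' G"
    and cN: "connected_mgraph N" "connected_mgraph N'"
    and cov: "vertex_cover G (verts N)" "vertex_cover G (verts N')"
    and U: "U \<subseteq> verts N" "U \<subseteq> verts N'"
    using N N' by (auto simp: nuclei_over_def nuclei_def)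
  have "verts N = verts N'"
  proof (cases "edges N = {}")
    case True
    then obtain v w where vw: "verts N = {v}" "verts N' = {w}"
      using cN eq by (metis connected_no_edges)
    have "v = w"
    proof (rule ccontr)
      assume "v \<noteq> w"
      then have "is_cK2 G"
        using is_cK2_if_two_point_covers[OF wf conn] cov vw by auto
      moreover have "U = {}" using U vw \<open>v \<noteq> w\<close> by auto
      ultimately show False using not_cK2 by simp
    qed
    then show ?thesis using vw by simp
  next
    case False
    have "wf_mgraph N" "wf_mgraph N'"
      using wf sub by (auto intro: wf_mgraph_subgraph)
    then have "verts N = \<Union> (ends N ` edges N)" "verts N' = \<Union> (ends N' ` edges N')"
      using connected_verts_eq_Union_ends cN False eq by metis+
    moreover have "ends N = ends N'"
      using sub by (simp add: subgraph_def)
    ultimately show ?thesis using eq by simp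
  qed
  then show "N = N'" using sub eq by (auto intro: subgraph_eqI)
qed

theorem reduced_euler_char_nucleus_complex:
  fixes G :: "('v, 'e) mgraph"
  assumes wf: "wf_mgraph G" and conn: "connected_mgraph G"
  shows "reduced_euler_char (nucleus_complex G U) =
     (\<Sum>N\<in>nuclei_over G U. (- 1) ^ (card (edges G - edges N) + 1))"
proof (cases "is_cK2 G \<and> U = {}")
  case True
  then have "nuclei_over G U = nuclei G"
    by (simp add: nuclei_over_def)
  moreover have "nucleus_complex G U = glued_simplices G"
    using True by (simp add: nucleus_complex_def)
  ultimately show ?thesis
    using True sum.reindex_bij_betw[OF bij_betw_nuclei_glued_simplices,
        of G "\<lambda>(l, \<sigma>). (- 1) ^ (card \<sigma> + 1) :: int"]
    by (simp add: reduced_euler_char_def)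
next
  case False
  let ?face = "\<lambda>N. (None, edges G - edges N) :: ('v, 'e) face"
  have "inj_on ?face (nuclei_over G U)"
  proof (rule inj_onI)
    fix N N'
    assume N: "N \<in> nuclei_over G U" "N' \<in> nuclei_over G U" "?face N = ?face N'"
    then have "edges N = edges N'"
      by (auto simp: nuclei_over_def nuclei_def subgraph_def)
    then show "N = N'"
      using N inj_on_edges_nuclei_over[OF wf conn False] by (auto dest: inj_onD)
  qed
  moreover have "nucleus_complex G U = ?face ` nuclei_over G U"
    using False by (auto simp: nucleus_complex_def simplicial_def nuclei_over_def)
  ultimately show ?thesis
    by (simp add: reduced_euler_char_def sum.reindex)
qed

section \<open>Contracting an edge\<close>

lemma mem_contract_vertex: "x \<in> contract_vertex G e x"
  by (simp add: contract_vertex_def)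

lemma contract_vertex_eqD:
  "contract_vertex G e x = contract_vertex G e y \<Longrightarrow>
     x = y \<or> x \<in> ends G e \<and> y \<in> ends G e"
  by (auto simp: contract_vertex_def split: if_splits)

lemma contract_vertex_eq_if_mem:
  "y \<in> contract_vertex G e x \<Longrightarrow> contract_vertex G e y = contract_vertex G e x"
  by (auto simp: contract_vertex_def split: if_splits)

lemma contract_vertex_cong:
  "ends H = ends G \<Longrightarrow> contract_vertex H e = contract_vertex G e"
  by (simp add: contract_vertex_def fun_eq_iff)

lemma contract_set_eq_image: "contract_set G e U = contract_vertex G e ` U"
  by (auto simp: contract_set_def contract_vertex_def image_iff)

lemma wf_contract_edge:
  assumes "wf_mgraph G"
  shows "wf_mgraph (contract_edge G e)"
proof -
  have "contract_vertex G e ` ends G f \<subseteq> contract_vertex G e ` verts G \<and>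
        card (contract_vertex G e ` ends G f) \<in> {1, 2}" if f: "f \<in> edges G" for f
  proof -
    obtain x y where "ends G f = {x, y}"
      using ends_cases[OF assms f] .
    then show ?thesis
      using assms f by (auto simp: wf_mgraph_def card_insert_if)
  qed
  then show ?thesis
    using assms by (auto simp: wf_mgraph_def contract_edge_def)
qed

text \<open>
  Contraction is applied to subgraphs \<open>N\<close> of the ambient graph as well, including those that miss
  \<open>e\<close> altogether; for these it only renames the vertices. A subgraph that contains an endpoint of
  \<open>e\<close> but not \<open>e\<close> is excluded: contraction might connect it, and might add the other endpoint.
\<close>

definition contractible_in :: "('v, 'e) mgraph \<Rightarrow> 'e \<Rightarrow> bool" where
  "contractible_in N e \<longleftrightarrow> e \<in> edges N \<or> ends N e \<inter> verts N = {}"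

lemma contractible_in_saturated:
  assumes "wf_mgraph N" and "contractible_in N e" and "y \<in> verts N"
    and "contract_vertex N e x = contract_vertex N e y"
  shows "x \<in> verts N"
proof (cases "x = y")
  case False
  then have "x \<in> ends N e" "y \<in> ends N e"
    using contract_vertex_eqD[OF assms(4)] by auto
  then show ?thesis
    using assms by (auto simp: contractible_in_def wf_mgraph_def)
qed (use assms in simp)

lemma contract_image_mem_iff:
  assumes "wf_mgraph N" and "contractible_in N e"
  shows "contract_vertex N e x \<in> contract_vertex N e ` verts N \<longleftrightarrow> x \<in> verts N"
  using contractible_in_saturated[OF assms] by blast

text \<open>
  Two vertices of \<open>N\<close> that are merged are joined by \<open>e\<close> in \<open>N\<close>; hence a walk in the contracted
  graph lifts to \<open>N\<close>, with \<open>e\<close> inserted where consecutive lifted edges do not meet.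
\<close>

lemma adj_rtrancl_if_contracted:
  assumes wf: "wf_mgraph N" and "contractible_in N e" and "x \<in> verts N"
    and eq: "contract_vertex N e x = contract_vertex N e y"
  shows "(x, y) \<in> (adj_rel N)\<^sup>*"
proof (cases "x = y")
  case False
  then have xy: "x \<in> ends N e" "y \<in> ends N e"
    using contract_vertex_eqD[OF eq] by auto
  then have e: "e \<in> edges N"
    using assms by (auto simp: contractible_in_def)
  obtain a b where "ends N e = {a, b}"
    using ends_cases[OF wf e] .
  then have "ends N e = {x, y}"
    using xy False by auto
  then show ?thesis using e by (auto simp: adj_rel_def)
qed simp

lemma adj_rtrancl_lift:
  assumes wf: "wf_mgraph N" and con: "contractible_in N e"
    and walk: "(X, Y) \<in> (adj_rel (contract_edge N e))\<^sup>*"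
    and x: "x \<in> verts N" "contract_vertex N e x = X"
    and y: "y \<in> verts N" "contract_vertex N e y = Y"
  shows "(x, y) \<in> (adj_rel N)\<^sup>*"
  using walk y
proof (induction arbitrary: y rule: rtrancl_induct)
  case base
  then show ?case using adj_rtrancl_if_contracted[OF wf con x(1)] x(2) by simp
next
  case (step Y Z)
  obtain f where f: "f \<in> edges N" and im: "contract_vertex N e ` ends N f = {Y, Z}"
    using step.hyps(2) by (auto simp: adj_rel_def contract_edge_def)
  obtain a b where ab: "ends N f = {a, b}"
    using ends_cases[OF wf f] .
  have ab': "{a, b} \<subseteq> verts N"
    using wf f ab by (auto simp: wf_mgraph_def)
  obtain y' z' where yz: "ends N f = {y', z'}"
    and c: "contract_vertex N e y' = Y" "contract_vertex N e z' = Z"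
  proof (cases "contract_vertex N e a = Y \<and> contract_vertex N e b = Z")
    case True
    then show thesis using that ab by blast
  next
    case False
    then have "contract_vertex N e b = Y \<and> contract_vertex N e a = Z"
      using im ab by (auto simp: doubleton_eq_iff)
    then show thesis using that[of b a] ab by blast
  qed
  have V: "y' \<in> verts N" "z' \<in> verts N" using yz ab ab' by auto
  have "(x, y') \<in> (adj_rel N)\<^sup>*" using step.IH V c by blast
  also have "(y', z') \<in> adj_rel N" using f yz by (auto simp: adj_rel_def)
  also have "(z', y) \<in> (adj_rel N)\<^sup>*"
    using adj_rtrancl_if_contracted[OF wf con V(2)] c step.prems by simp
  finally show ?case .
qed

lemma adj_rtrancl_contract:
  assumes "(x, y) \<in> (adj_rel N)\<^sup>*"
  shows "(contract_vertex N e x, contract_vertex N e y) \<in> (adj_rel (contract_edge N e))\<^sup>*"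
  using assms
proof (induction rule: rtrancl_induct)
  case (step y z)
  then obtain f where f: "f \<in> edges N" "ends N f = {y, z}"
    by (auto simp: adj_rel_def)
  show ?case
  proof (cases "f = e")
    case True
    then have "contract_vertex N e y = contract_vertex N e z"
      using f by (simp add: contract_vertex_def)
    then show ?thesis using step.IH by simp
  next
    case False
    then have "(contract_vertex N e y, contract_vertex N e z) \<in> adj_rel (contract_edge N e)"
      using f by (auto simp: adj_rel_def contract_edge_def)
    then show ?thesis using step.IH by simp
  qed
qed simp

lemma connected_contract_edge_iff:
  assumes "wf_mgraph N" and "contractible_in N e"
  shows "connected_mgraph (contract_edge N e) \<longleftrightarrow> connected_mgraph N"
proof -
  have V: "verts (contract_edge N e) = contract_vertex N e ` verts N"
    by (simp add: contract_edge_def)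
  have "(contract_vertex N e x, contract_vertex N e y) \<in> (adj_rel (contract_edge N e))\<^sup>* \<longleftrightarrow>
      (x, y) \<in> (adj_rel N)\<^sup>*" if "x \<in> verts N" "y \<in> verts N" for x y
    using adj_rtrancl_lift[OF assms _ that(1) refl that(2) refl]
      adj_rtrancl_contract[of x y N e] by (rule iffI)
  then show ?thesis
    unfolding connected_mgraph_iff_adj V by simp
qed

section \<open>Subgraphs of the contracted graph\<close>

text \<open>
  A vertex of \<open>G / e\<close> is the set of vertices of \<open>G\<close> merged into it, so lifting a vertex set is a
  union.
\<close>

definition uncontract ::
  "('v, 'e) mgraph \<Rightarrow> 'e \<Rightarrow> ('v set, 'e) mgraph \<Rightarrow> ('v, 'e) mgraph" where
  "uncontract G e M =
     \<lparr>verts = \<Union> (verts M),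
      edges = (if ends G e \<in> verts M then insert e (edges M) else edges M),
      ends = ends G\<rparr>"

lemma subgraph_contract_edge:
  assumes "subgraph N G"
  shows "subgraph (contract_edge N e) (contract_edge G e)"
proof -
  have ends: "ends N = ends G" using assms by (simp add: subgraph_def)
  then have "contract_vertex N e = contract_vertex G e"
    by (rule contract_vertex_cong)
  then show ?thesis
    using assms ends by (auto simp: subgraph_def contract_edge_def intro!: imageI)
qed

lemma uncontract_contract_edge:
  assumes wf: "wf_mgraph G" and e: "e \<in> edges G"
    and sub: "subgraph N G" and con: "contractible_in N e"
  shows "uncontract G e (contract_edge N e) = N"
proof -
  have ends: "ends N = ends G" using sub by (simp add: subgraph_def)
  have wfN: "wf_mgraph N" using wf_mgraph_subgraph[OF wf sub] .
  have cv: "contract_vertex N e = contract_vertex G e"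
    using ends by (rule contract_vertex_cong)
  have "\<Union> (contract_vertex N e ` verts N) = verts N"
  proof
    show "verts N \<subseteq> \<Union> (contract_vertex N e ` verts N)"
      using mem_contract_vertex by fast
    show "\<Union> (contract_vertex N e ` verts N) \<subseteq> verts N"
      by (auto intro: contractible_in_saturated[OF wfN con] dest: contract_vertex_eq_if_mem)
  qed
  moreover have "ends G e \<in> contract_vertex N e ` verts N \<longleftrightarrow> e \<in> edges N"
  proof -
    obtain v w where vw: "ends G e = {v, w}" using ends_cases[OF wf e] .
    then have "ends G e = contract_vertex N e v"
      using cv by (simp add: contract_vertex_def)
    then have "ends G e \<in> contract_vertex N e ` verts N \<longleftrightarrow> v \<in> verts N"
      using contract_image_mem_iff[OF wfN con] by simp
    also have "\<dots> \<longleftrightarrow> e \<in> edges N"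
      using con wfN vw ends by (auto simp: contractible_in_def wf_mgraph_def)
    finally show ?thesis .
  qed
  ultimately show ?thesis
    using ends by (auto simp: uncontract_def contract_edge_def intro!: mgraph.equality)
qed

lemma subgraph_of_contraction_lift:
  assumes wf: "wf_mgraph G" and e: "e \<in> edges G" and sub: "subgraph M (contract_edge G e)"
  shows "subgraph (uncontract G e M) G"
    and "contractible_in (uncontract G e M) e"
    and "contract_edge (uncontract G e M) e = M"
proof -
  let ?c = "contract_vertex G e"
  have vM: "verts M \<subseteq> ?c ` verts G" and eM: "edges M \<subseteq> edges G - {e}"
    and endsM: "ends M = (\<lambda>f. ?c ` ends G f)"
    using sub by (simp_all add: subgraph_def contract_edge_def)
  have inM: "?c ` ends G f \<subseteq> verts M" if "f \<in> edges M" for f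
  proof -
    have "ends M f \<subseteq> verts M" using subgraph_ends[OF sub that] .
    then show ?thesis by (simp add: endsM)
  qed
  have endse: "ends G e \<subseteq> verts G"
    using wf e by (auto simp: wf_mgraph_def)
  \<comment> \<open>the members of \<open>verts M\<close> are the fibres of \<open>?c\<close>\<close>
  have mem: "x \<in> \<Union> (verts M) \<longleftrightarrow> ?c x \<in> verts M" for x
  proof
    assume "x \<in> \<Union> (verts M)"
    then obtain y where "?c y \<in> verts M" "x \<in> ?c y" using vM by blast
    then show "?c x \<in> verts M" using contract_vertex_eq_if_mem by metis
  next
    assume "?c x \<in> verts M"
    then show "x \<in> \<Union> (verts M)" using mem_contract_vertex by fast
  qed
  have endsM_iff: "ends G e \<in> verts M \<longleftrightarrow> x \<in> \<Union> (verts M)" if "x \<in> ends G e" for x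
    using mem[of x] that by (simp add: contract_vertex_def)
  have "\<Union> (verts M) \<subseteq> verts G"
    using vM endse by (auto simp: contract_vertex_def split: if_splits)
  moreover have "ends G f \<subseteq> \<Union> (verts M)" if "f \<in> edges M" for f
  proof
    fix x assume "x \<in> ends G f"
    then have "?c x \<in> verts M" using inM[OF that] by blast
    then show "x \<in> \<Union> (verts M)" by (simp only: mem)
  qed
  ultimately show "subgraph (uncontract G e M) G"
    using eM e endsM_iff by (auto simp: subgraph_def uncontract_def)
  show "contractible_in (uncontract G e M) e"
    using endsM_iff by (auto simp: contractible_in_def uncontract_def)
  have "?c ` \<Union> (verts M) = verts M"
  proof
    show "?c ` \<Union> (verts M) \<subseteq> verts M"
      by (rule image_subsetI) (simp only: mem)
    show "verts M \<subseteq> ?c ` \<Union> (verts M)"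
    proof
      fix X assume X: "X \<in> verts M"
      then obtain x where "X = ?c x" using vM by blast
      then show "X \<in> ?c ` \<Union> (verts M)" using X mem[of x] by (simp only: imageI)
    qed
  qed
  moreover have "contract_vertex (uncontract G e M) e = ?c"
    by (rule contract_vertex_cong) (simp add: uncontract_def)
  ultimately show "contract_edge (uncontract G e M) e = M"
    using eM endsM
    by (auto simp: contract_edge_def uncontract_def intro!: mgraph.equality)
qed

text \<open>
  For \<open>C = verts N\<close> saturated under the merging, an edge of \<open>G / e\<close> meets the image of \<open>C\<close> exactly
  if it meets \<open>C\<close> in \<open>G\<close>. The edge \<open>e\<close> imposes no condition on either side.
\<close>

lemma vertex_cover_contract_edge_iff:
  assumes wf: "wf_mgraph G" and sub: "subgraph N G" and con: "contractible_in N e"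
  shows "vertex_cover (contract_edge G e) (verts (contract_edge N e)) \<longleftrightarrow>
     vertex_cover (delete_edge G e) (verts N)"
proof -
  have wfN: "wf_mgraph N" using wf_mgraph_subgraph[OF wf sub] .
  have cv: "contract_vertex G e = contract_vertex N e"
    using sub by (intro contract_vertex_cong) (simp add: subgraph_def)
  have "contract_vertex N e ` S \<inter> contract_vertex N e ` verts N \<noteq> {} \<longleftrightarrow> S \<inter> verts N \<noteq> {}"
    for S
    using contract_image_mem_iff[OF wfN con] by blast
  moreover have "verts N \<subseteq> verts G"
    using sub by (simp add: subgraph_def)
  ultimately show ?thesis
    by (auto simp: vertex_cover_def contract_edge_def delete_edge_def cv)
qed

lemma contract_set_subset_iff:
  assumes wf: "wf_mgraph G" and sub: "subgraph N G" and con: "contractible_in N e"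
  shows "contract_set G e U \<subseteq> verts (contract_edge N e) \<longleftrightarrow> U \<subseteq> verts N"
proof -
  have wfN: "wf_mgraph N" using wf_mgraph_subgraph[OF wf sub] .
  have cv: "contract_vertex G e = contract_vertex N e"
    using sub by (intro contract_vertex_cong) (simp add: subgraph_def)
  have "contract_vertex N e ` U \<subseteq> contract_vertex N e ` verts N \<longleftrightarrow> U \<subseteq> verts N"
    using contract_image_mem_iff[OF wfN con] by (metis image_mono image_subset_iff subsetI)
  then show ?thesis
    by (simp add: contract_set_eq_image contract_edge_def cv)
qed

lemma bij_betw_contract_nuclei:
  assumes wf: "wf_mgraph G" and e: "e \<in> edges G"
  shows "bij_betw (\<lambda>N. contract_edge N e)
     {N. subgraph N G \<and> connected_mgraph N \<and> contractible_in N e \<and>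
         vertex_cover (delete_edge G e) (verts N) \<and> U \<subseteq> verts N}
     (nuclei_over (contract_edge G e) (contract_set G e U))"
    (is "bij_betw ?f ?A ?B")
proof -
  have iff: "contract_edge N e \<in> ?B \<longleftrightarrow> N \<in> ?A"
    if sub: "subgraph N G" and con: "contractible_in N e" for N
    using subgraph_contract_edge[OF sub, of e]
      connected_contract_edge_iff[OF wf_mgraph_subgraph[OF wf sub] con]
      vertex_cover_contract_edge_iff[OF wf sub con] contract_set_subset_iff[OF wf sub con, of U]
      sub con
    by (auto simp: nuclei_over_def nuclei_def)
  show ?thesis
  proof (rule bij_betw_byWitness[where f' = "uncontract G e"])
    show "\<forall>N\<in>?A. uncontract G e (contract_edge N e) = N"
      using uncontract_contract_edge[OF wf e] by blast
    show "\<forall>M\<in>?B. contract_edge (uncontract G e M) e = M"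
      using subgraph_of_contraction_lift(3)[OF wf e] by (auto simp: nuclei_over_def nuclei_def)
    show "?f ` ?A \<subseteq> ?B" using iff by blast
    show "uncontract G e ` ?B \<subseteq> ?A"
    proof
      fix N assume "N \<in> uncontract G e ` ?B"
      then obtain M where M: "M \<in> ?B" and N: "N = uncontract G e M" by blast
      then have "subgraph M (contract_edge G e)"
        by (simp add: nuclei_over_def nuclei_def)
      note lift = subgraph_of_contraction_lift[OF wf e this, folded N]
      show "N \<in> ?A" using iff[OF lift(1,2)] lift(3) M by simp
    qed
  qed
qed

section \<open>Deleting an edge\<close>

lemma wf_delete_edge: "wf_mgraph G \<Longrightarrow> wf_mgraph (delete_edge G e)"
  by (auto simp: wf_mgraph_def delete_edge_def)

lemma equiv_reach_rel: "equiv (verts G) (reach_rel G)"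
proof -
  have "sym (adj_rel G)"
    by (auto simp: adj_rel_def sym_def insert_commute)
  then have "sym ((adj_rel G)\<^sup>*)" by (rule sym_rtrancl)
  then show ?thesis
    unfolding reach_rel_def
    by (intro equivI) (auto simp: refl_on_def sym_def trans_def)
qed

lemma connected_delete_edge:
  assumes wf: "wf_mgraph G" and conn: "connected_mgraph G"
    and e: "e \<in> edges G" and not_cut: "\<not> cut_edge G e"
  shows "connected_mgraph (delete_edge G e)"
proof -
  let ?H = "delete_edge G e"
  have V: "verts ?H = verts G" by (simp add: delete_edge_def)
  have fin: "finite (components ?H)"
    unfolding components_def
    by (rule finite_quotient) (use wf V in \<open>auto simp: wf_mgraph_def reach_rel_def\<close>)
  have "components G = {verts G}"
    using conn
    by (auto simp: components_def quotient_def connected_mgraph_def reach_rel_def Image_def)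
  then have le: "card (components ?H) \<le> Suc 0"
    using not_cut e by (simp add: cut_edge_def)
  have "(x, y) \<in> reach_rel ?H" if xy: "x \<in> verts ?H" "y \<in> verts ?H" for x y
  proof -
    have "reach_rel ?H `` {x} \<in> components ?H" "reach_rel ?H `` {y} \<in> components ?H"
      using xy by (auto simp: components_def intro: quotientI)
    then have "reach_rel ?H `` {x} = reach_rel ?H `` {y}"
      using le fin by (auto simp: card_le_Suc0_iff_eq)
    then show ?thesis
      using eq_equiv_class[OF _ equiv_reach_rel] xy by fast
  qed
  then show ?thesis
    using conn V by (auto simp: connected_mgraph_def)
qed

section \<open>The deletion-contraction formula\<close>

theorem theorem5p2:
  fixes G :: "('v, 'e) mgraph" and e :: 'e and U :: "'v set"
  assumes "wf_mgraph G" and "connected_mgraph G" and "card (verts G) \<ge> 2"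
    and "e \<in> edges G" and "\<not> is_loop G e" and "\<not> cut_edge G e"
    and "U \<subseteq> verts G"
  shows "reduced_euler_char (nucleus_complex G U) =
           reduced_euler_char (nucleus_complex (contract_edge G e) (contract_set G e U))
           - reduced_euler_char (nucleus_complex (delete_edge G e) U)"
proof -
  note wf = \<open>wf_mgraph G\<close> and conn = \<open>connected_mgraph G\<close> and e = \<open>e \<in> edges G\<close>
  have finE: "finite (edges G)" using wf by (simp add: wf_mgraph_def)
  define A where "A = {N \<in> nuclei_over G U. e \<in> edges N}"
  define B where "B = {N \<in> nuclei_over G U. e \<notin> edges N}"
  define C where "C = {N \<in> nuclei_over (delete_edge G e) U. ends G e \<inter> verts N = {}}"
  define s :: "('v, 'e) mgraph \<Rightarrow> int"
    where "s N = (- 1) ^ (card (edges G - {e} - edges N) + 1)" for N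

  have G_split: "nuclei_over G U = A \<union> B"
    by (auto simp: A_def B_def)
  have delete_split: "nuclei_over (delete_edge G e) U = B \<union> C"
  proof -
    have "N \<in> nuclei_over (delete_edge G e) U \<and> ends G e \<inter> verts N \<noteq> {} \<longleftrightarrow> N \<in> B" for N
      using e by (auto simp: B_def nuclei_over_def nuclei_def subgraph_def vertex_cover_def
          delete_edge_def)
    then show ?thesis by (auto simp: C_def)
  qed
  have contract_split: "bij_betw (\<lambda>N. contract_edge N e) (A \<union> C)
      (nuclei_over (contract_edge G e) (contract_set G e U))"
  proof -
    \<comment> \<open>A subgraph that uses \<open>e\<close> covers \<open>e\<close>, so for it being a cover of \<open>G\<close> and of \<open>G \ e\<close> is
      the same; one without endpoints of \<open>e\<close> is a subgraph of \<open>G \ e\<close>.\<close>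
    have nonempty: "ends G e \<noteq> {}"
      using ends_cases[OF wf e] by (metis insert_not_empty)
    have "A \<union> C = {N. subgraph N G \<and> connected_mgraph N \<and> contractible_in N e \<and>
         vertex_cover (delete_edge G e) (verts N) \<and> U \<subseteq> verts N}" (is "_ = ?R")
    proof (intro set_eqI)
      fix N :: "('v, 'e) mgraph"
      have cover: "vertex_cover G (verts N) \<longleftrightarrow>
          vertex_cover (delete_edge G e) (verts N) \<and> ends G e \<inter> verts N \<noteq> {}"
        using e by (auto simp: vertex_cover_def delete_edge_def)
      show "N \<in> A \<union> C \<longleftrightarrow> N \<in> ?R"
      proof (cases "e \<in> edges N")
        case True
        have "ends G e \<inter> verts N \<noteq> {}" if "subgraph N G"
        proof -
          have "ends N e \<subseteq> verts N"
            using subgraph_ends[OF that True] .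
          moreover have "ends N = ends G" using that by (simp add: subgraph_def)
          ultimately show ?thesis using nonempty by auto
        qed
        moreover have "N \<notin> C"
          using True by (auto simp: C_def nuclei_over_def nuclei_def subgraph_def delete_edge_def)
        ultimately show ?thesis
          using True cover
          by (auto simp: A_def nuclei_over_def nuclei_def contractible_in_def)
      next
        case False
        then show ?thesis
          by (auto simp: A_def C_def nuclei_over_def nuclei_def subgraph_def delete_edge_def
              contractible_in_def)
      qed
    qed
    then show ?thesis using bij_betw_contract_nuclei[OF wf e, of U] by simp
  qed

  have "finite (A \<union> B)" "finite (B \<union> C)"
    using finite_nuclei[OF wf] finite_nuclei[OF wf_delete_edge[OF wf]]
    by (simp_all flip: G_split delete_split add: nuclei_over_def)
  then have fin: "finite A" "finite B" "finite C" by auto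
  have disj: "A \<inter> B = {}" "B \<inter> C = {}" "A \<inter> C = {}"
    using e by (auto simp: A_def B_def C_def nuclei_over_def nuclei_def vertex_cover_def
        subgraph_def delete_edge_def)

  have sign_A: "(- 1) ^ (card (edges G - edges N) + 1) = s N" if "N \<in> A" for N
  proof -
    have "edges G - edges N = edges G - {e} - edges N"
      using that by (auto simp: A_def)
    then show ?thesis by (simp add: s_def)
  qed
  have sign_B: "(- 1) ^ (card (edges G - edges N) + 1) = - s N" if "N \<in> B" for N
  proof -
    have "edges G - edges N = insert e (edges G - {e} - edges N)"
      using that e by (auto simp: B_def)
    then have "card (edges G - edges N) = Suc (card (edges G - {e} - edges N))"
      using finE by simp
    then show ?thesis by (simp add: s_def)
  qed

  have "reduced_euler_char (nucleus_complex G U) =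
      (\<Sum>N\<in>A \<union> B. (- 1) ^ (card (edges G - edges N) + 1))"
    using reduced_euler_char_nucleus_complex[OF wf conn] G_split by simp
  also have "\<dots> = (\<Sum>N\<in>A. s N) + (\<Sum>N\<in>B. - s N)"
    using sign_A sign_B by (simp add: sum.union_disjoint[OF fin(1,2) disj(1)])
  finally have eq_G: "reduced_euler_char (nucleus_complex G U) = sum s A - sum s B"
    by (simp add: sum_negf)

  have "reduced_euler_char (nucleus_complex (delete_edge G e) U) = sum s (B \<union> C)"
    using reduced_euler_char_nucleus_complex[OF wf_delete_edge[OF wf]
        connected_delete_edge[OF wf conn e \<open>\<not> cut_edge G e\<close>]] delete_split
    by (simp add: s_def delete_edge_def)
  then have eq_delete:
    "reduced_euler_char (nucleus_complex (delete_edge G e) U) = sum s B + sum s C"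
    by (simp add: sum.union_disjoint[OF fin(2,3) disj(2)])

  have conn_contract: "connected_mgraph (contract_edge G e)"
    using connected_contract_edge_iff[OF wf] conn e by (simp add: contractible_in_def)
  have "reduced_euler_char (nucleus_complex (contract_edge G e) (contract_set G e U)) =
      (\<Sum>N\<in>A \<union> C. (- 1) ^
         (card (edges (contract_edge G e) - edges (contract_edge N e)) + 1))"
    using reduced_euler_char_nucleus_complex[OF wf_contract_edge[OF wf] conn_contract]
      sum.reindex_bij_betw[OF contract_split, symmetric] by simp
  also have "\<dots> = sum s (A \<union> C)"
  proof (rule sum.cong[OF refl])
    fix N :: "('v, 'e) mgraph"
    have "edges (contract_edge G e) - edges (contract_edge N e) = edges G - {e} - edges N"
      by (auto simp: contract_edge_def)
    then show "(- 1) ^ (card (edges (contract_edge G e) - edges (contract_edge N e)) + 1) = s N"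
      by (simp add: s_def)
  qed
  finally have eq_contract:
    "reduced_euler_char (nucleus_complex (contract_edge G e) (contract_set G e U)) =
       sum s A + sum s C"
    by (simp add: sum.union_disjoint[OF fin(1,3) disj(3)])

  show ?thesis using eq_G eq_delete eq_contract by simp
qed

end
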